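(* Let $\lambda$ be a strict partition with associated signed index set $I_\lambda$. For complex constants $r=(r_{i,j})$, indexed by pairs $i,j\in I_\lambda$ with $i>|j|$, put $$L_\lambda(r):=\tilde M+\sum_{\substack{i,j\in I_\lambda\\ i>|j|}}r_{i,j}\,[E_{i,j}-E_{j,i}]-\sum_{\substack{i,j\in I_\lambda\\ i,j>0}}r_{i,0}\,r_{j,0}\,E_{i,j}.$$ Then the columns of $L_\lambda(r)$ with labels in $I_\lambda$ give a canonical form for the elements of the Schubert cell $\mathcal L_\lambda$ of the universal orthogonal Grassmannian manifold, and the $r_{i,j}$ are arbitrary constants providing an inhomogeneous coordinate system on $\mathcal L_\lambda$; that is, $r\mapsto\mathrm{span}\{\text{columns of }L_\lambda(r)\text{ with label in }I_\lambda\}$ is a bijection from the set of all families $r$ of complex numbers onto $\mathcal L_\lambda$.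
   Context: Index set: $A=(\dots,-2,-1,-0,+0,1,2,\dots)$, totally ordered as written; $-0\neq+0$, negation exchanges them, and $|\pm0|=0$; neither of $\pm0$ counts as $>0$. Matrices have rows (top to bottom) and columns (left to right) labelled by $A$. $\tilde E_{i,j}$ is the matrix unit at row $i$, column $j$. For $i,j\notin\{+0,-0\}$, $E_{i,j}=\tilde E_{i,j}$; and $E_{i,0}=\tilde E_{i,+0}+\tilde E_{i,-0}$, $E_{0,i}=\tilde E_{+0,i}+\tilde E_{-0,i}$. When an index in $I_\lambda$ equals $+0$ or $-0$ it is read as $0$ in $r_{i,j}$ and in $E_{i,j}$. Quadratic form: $\hat V$ is the space of formal vectors $x=\sum_{\alpha\in A}x_\alpha e_\alpha$ with $x_\alpha=0$ for all sufficiently negative $\alpha$, with $\tilde Q(x)=\sum_{k\ge0}(-1)^kx_{+k}x_{-k}$. $\tilde M=\sum_{k\ge0}(-1)^k(\tilde E_{+k,-k}+\tilde E_{-k,+k})$ is the Gram matrix of the associated bilinear form $\tilde\Psi$ ($\tilde\Psi(x,x)=2\tilde Q(x)$). The orthogonal Lie algebra $\mathfrak b_\infty$ belongs to the quadratic subspace orthogonal to $e_{-0}-e_{+0}$; maximal isotropic subspaces for it are realized inside the larger space $\hat V$. Index set of $\lambda$: write the strict partition $\lambda$ with an even number of parts $\lambda_1>\dots>\lambda_{2\ell}\ge0$ (append a part $0$ if the number of positive parts is odd). $I_\lambda\subset A$ contains, for each integer $j\ge0$, exactly one of $+j,-j$: it contains $-j$ if $j\in\{\lambda_1,\dots,\lambda_{2\ell}\}$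 and $+j$ otherwise. The corresponding Weyl group element $w_\lambda$ changes the sign of the short roots $\varepsilon_{\lambda_j}$ ($\lambda_j\neq0$) and fixes the others; it carries $\mathrm{span}\{e_{-0},e_{-1},e_{-2},\dots\}$ to $U_\lambda=\mathrm{span}\{e_{-i}:i\in I_\lambda\}$. Schubert cell: $\mathcal N_-$ is the group of lower unitriangular $A\times A$ complex matrices preserving $\tilde Q$ and fixing $e_{-0}-e_{+0}$ (it acts on $\hat V$). $\mathcal L_\lambda=\{N\cdot U_\lambda:N\in\mathcal N_-\}$, a set of maximal isotropic subspaces of $\hat V$; the universal orthogonal Grassmannian manifold is the disjoint union of the $\mathcal L_\lambda$ over strict partitions $\lambda$. *)

theory Defs
  imports "HOL-Analysis.Analysis" "HOL-Library.Function_Algebras"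
begin

text \<open>
  The index set \<open>\<dots> < -2 < -1 < -0 < +0 < 1 < 2 < \<dots>\<close>:
  \<open>Neg k\<close> is \<open>-k\<close> and \<open>Pos k\<close> is \<open>+k\<close>, so that \<open>Neg 0\<close> and \<open>Pos 0\<close>
  are the two distinct zeros.
\<close>

datatype idx = Neg nat | Pos nat

fun idx_le :: "idx \<Rightarrow> idx \<Rightarrow> bool" where
  "idx_le (Neg m) (Neg n) \<longleftrightarrow> n \<le> m"
| "idx_le (Neg m) (Pos n) \<longleftrightarrow> True"
| "idx_le (Pos m) (Neg n) \<longleftrightarrow> False"
| "idx_le (Pos m) (Pos n) \<longleftrightarrow> m \<le> n"

fun idx_uminus :: "idx \<Rightarrow> idx" where
  "idx_uminus (Neg n) = Pos n"
| "idx_uminus (Pos n) = Neg n"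

instantiation idx :: linorder
begin

definition less_eq_idx :: "idx \<Rightarrow> idx \<Rightarrow> bool" where
  "a \<le> b \<longleftrightarrow> idx_le a b"

definition less_idx :: "idx \<Rightarrow> idx \<Rightarrow> bool" where
  "(a::idx) < b \<longleftrightarrow> a \<le> b \<and> a \<noteq> b"

instance
proof
  fix x y z :: idx
  show "(x < y) = (x \<le> y \<and> \<not> y \<le> x)"
    by (cases x; cases y) (auto simp: less_idx_def less_eq_idx_def)
  show "x \<le> x"
    by (cases x) (auto simp: less_eq_idx_def)
  show "x \<le> y \<Longrightarrow> y \<le> z \<Longrightarrow> x \<le> z"
    by (cases x; cases y; cases z) (auto simp: less_eq_idx_def)
  show "x \<le> y \<Longrightarrow> y \<le> x \<Longrightarrow> x = y"
    by (cases x; cases y) (auto simp: less_eq_idx_def)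
  show "x \<le> y \<or> y \<le> x"
    by (cases x; cases y) (auto simp: less_eq_idx_def)
qed

end

instantiation idx :: uminus
begin

definition uminus_idx :: "idx \<Rightarrow> idx" where
  "- a = idx_uminus a"

instance ..

end

text \<open>
  The integer value of an index, which reads both zeros as \<open>0\<close>. The conditions
  \<open>i > |j|\<close> and \<open>i > 0\<close>, and the subscripts of \<open>r\<close>, refer to it.
\<close>

fun ival :: "idx \<Rightarrow> int" where
  "ival (Neg n) = - int n"
| "ival (Pos n) = int n"

type_synonym cvec = "idx \<Rightarrow> complex"
type_synonym cmat = "idx \<Rightarrow> idx \<Rightarrow> complex"

text \<open>
  Matrices are functions of row and column. The infinite sums below are formal:
  in every use only finitely many summands are nonzero (for sums of matrices, in
  each entry).
\<close>

definition cscale :: "complex \<Rightarrow> cvec \<Rightarrow> cvec" where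
  "cscale c x = (\<lambda>a. c * x a)"

interpretation cvec: vector_space cscale
  by unfold_locales (auto simp: cscale_def fun_eq_iff algebra_simps)

definition unit_vec :: "idx \<Rightarrow> cvec" where
  "unit_vec a = (\<lambda>b. if b = a then 1 else 0)"

definition mat_unit :: "idx \<Rightarrow> idx \<Rightarrow> cmat" where
  "mat_unit i j = (\<lambda>a b. if a = i \<and> b = j then 1 else 0)"

text \<open>
  \<open>E\<^sub>i\<^sub>,\<^sub>j\<close>, with an index \<open>+0\<close> or \<open>-0\<close> read as \<open>0\<close>. It is never used with both
  indices zero.
\<close>

definition E_mat :: "idx \<Rightarrow> idx \<Rightarrow> cmat" where
  "E_mat i j =
     (if ival i = 0 then mat_unit (Pos 0) j + mat_unit (Neg 0) j
      else if ival j = 0 then mat_unit i (Pos 0) + mat_unit i (Neg 0)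
      else mat_unit i j)"

definition mat_vec :: "cmat \<Rightarrow> cvec \<Rightarrow> cvec" where
  "mat_vec N x = (\<lambda>a. \<Sum>\<^sub>\<infinity>b. N a b * x b)"

definition V_hat :: "cvec set" where
  "V_hat = {x. \<exists>m. \<forall>a<m. x a = 0}"

definition Q_tilde :: "cvec \<Rightarrow> complex" where
  "Q_tilde x = (\<Sum>\<^sub>\<infinity>k::nat. (-1) ^ k * x (Pos k) * x (Neg k))"

definition M_tilde :: cmat where
  "M_tilde = (\<lambda>a b. \<Sum>\<^sub>\<infinity>k::nat.
     (-1) ^ k * (mat_unit (Pos k) (Neg k) a b + mat_unit (Neg k) (Pos k) a b))"

text \<open>A strict partition is the strictly decreasing list of its positive parts.\<close>

definition strict_partition :: "nat list \<Rightarrow> bool" where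
  "strict_partition lam \<longleftrightarrow> sorted_wrt (>) lam \<and> (\<forall>p\<in>set lam. 0 < p)"

definition even_parts :: "nat list \<Rightarrow> nat list" where
  "even_parts lam = (if odd (length lam) then lam @ [0] else lam)"

definition I_set :: "nat list \<Rightarrow> idx set" where
  "I_set lam = Neg ` set (even_parts lam) \<union> Pos ` (- set (even_parts lam))"

definition U_space :: "nat list \<Rightarrow> cvec set" where
  "U_space lam = cvec.span {unit_vec (- i) | i. i \<in> I_set lam}"

definition N_minus :: "cmat set" where
  "N_minus = {N. (\<forall>a b. a < b \<longrightarrow> N a b = 0) \<and> (\<forall>a. N a a = 1) \<and>
     (\<forall>x\<in>V_hat. Q_tilde (mat_vec N x) = Q_tilde x) \<and>
     mat_vec N (unit_vec (Neg 0) - unit_vec (Pos 0)) = unit_vec (Neg 0) - unit_vec (Pos 0)}"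

definition schubert_cell :: "nat list \<Rightarrow> cvec set set" where
  "schubert_cell lam = {mat_vec N ` U_space lam | N. N \<in> N_minus}"

definition idx_pairs :: "nat list \<Rightarrow> (idx \<times> idx) set" where
  "idx_pairs lam = {(i, j). i \<in> I_set lam \<and> j \<in> I_set lam \<and> ival i > \<bar>ival j\<bar>}"

text \<open>
  The families \<open>r\<close>: since \<open>I_set lam\<close> contains exactly one of the two zeros, its pairs
  correspond bijectively to the pairs of integers used as subscripts. Outside these
  subscripts \<open>r\<close> is \<open>undefined\<close>, as usual for \<open>PiE\<close>.
\<close>

definition r_families :: "nat list \<Rightarrow> (int \<times> int \<Rightarrow> complex) set" where
  "r_families lam = {(ival i, ival j) | i j. (i, j) \<in> idx_pairs lam} \<rightarrow>\<^sub>E UNIV"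

definition L_mat :: "nat list \<Rightarrow> (int \<times> int \<Rightarrow> complex) \<Rightarrow> cmat" where
  "L_mat lam r = (\<lambda>a b. M_tilde a b
     + (\<Sum>\<^sub>\<infinity>(i, j)\<in>idx_pairs lam.
          r (ival i, ival j) * (E_mat i j a b - E_mat j i a b))
     - (\<Sum>\<^sub>\<infinity>(i, j)\<in>{(i, j). i \<in> I_set lam \<and> j \<in> I_set lam \<and> ival i > 0 \<and> ival j > 0}.
          r (ival i, 0) * r (ival j, 0) * E_mat i j a b))"

definition mat_col :: "cmat \<Rightarrow> idx \<Rightarrow> cvec" where
  "mat_col X j = (\<lambda>a. X a j)"

definition column_span :: "nat list \<Rightarrow> (int \<times> int \<Rightarrow> complex) \<Rightarrow> cvec set" where
  "column_span lam r = cvec.span {mat_col (L_mat lam r) j | j. j \<in> I_set lam}"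

end

theory Submission
  imports Defs
begin

text \<open>
  Up to the signs \<open>(-1)\<^sup>j\<close>, column reduction brings the columns of \<open>L\<^sub>\<lambda>(r)\<close> with label \<open>j \<in> I\<^sub>\<lambda>\<close> to the
  form \<open>e\<^sub>-\<^sub>j + \<Sum>\<^sub>i S\<^sub>i\<^sub>j e\<^sub>i\<close> with \<open>i \<in> I\<^sub>\<lambda>\<close>, where \<open>S\<close> is the skew matrix with lower part \<open>r\<close>. Such a basis
  is a reduced echelon form, hence determined by its span, which gives injectivity. Conversely
  the columns of an element of \<open>N_minus\<close> with labels outside \<open>I\<^sub>\<lambda>\<close> can be reduced to echelon
  form, since these labels are bounded above and each reduction involves only finitely many
  columns; isotropy of the span makes the reduced matrix skew. Finally the span of the
  columns of \<open>L\<^sub>\<lambda>(r)\<close> lies in the cell because the columns themselves extend to an explicit element of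
  \<open>N_minus\<close>. Fixing \<open>e\<^sub>-\<^sub>0 - e\<^sub>+\<^sub>0\<close> forces one further column of that element to depend on \<open>r\<close>, and
  the quadratic term of \<open>L\<^sub>\<lambda>(r)\<close> compensates for it in the quadratic form.
\<close>

section \<open>Order, negation and signs on the index set; the set \<open>I_set lam\<close>\<close>

lemma uminus_idx_simps [simp]:
  "- Neg n = Pos n" "- Pos n = Neg n"
  by (simp_all add: uminus_idx_def)

lemma uminus_uminus_idx [simp]: "- (- a) = (a :: idx)"
  by (cases a) simp_all

lemma uminus_idx_eq_iff [simp]: "- a = - b \<longleftrightarrow> a = (b :: idx)"
  by (metis uminus_uminus_idx)

lemma uminus_idx_neq [simp]: "- a \<noteq> (a :: idx)" "a \<noteq> - (a :: idx)"
  by (cases a; simp)+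

lemma ival_uminus [simp]: "ival (- a) = - ival a"
  by (cases a) simp_all

lemma le_idx_simps [simp]:
  "Neg m \<le> Neg n \<longleftrightarrow> n \<le> m" "Neg m \<le> Pos n" "\<not> Pos m \<le> Neg n" "Pos m \<le> Pos n \<longleftrightarrow> m \<le> n"
  by (simp_all add: less_eq_idx_def)

lemma less_idx_simps [simp]:
  "Neg m < Neg n \<longleftrightarrow> n < m" "Neg m < Pos n" "\<not> Pos m < Neg n" "Pos m < Pos n \<longleftrightarrow> m < n"
  by (auto simp: less_idx_def)

lemma finite_idx_interval: "finite {a::idx. m \<le> a \<and> a \<le> n}"
proof (rule finite_subset)
  let ?k = "nat \<bar>ival m\<bar> + nat \<bar>ival n\<bar>"
  show "{a. m \<le> a \<and> a \<le> n} \<subseteq> Neg ` {..?k} \<union> Pos ` {..?k}"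
  proof
    fix a assume "a \<in> {a. m \<le> a \<and> a \<le> n}"
    then show "a \<in> Neg ` {..?k} \<union> Pos ` {..?k}"
      by (cases a; cases m; cases n) auto
  qed
qed simp

text \<open>The coefficient of the pair \<open>+k\<close>, \<open>-k\<close> in
  \<open>Q_tilde\<close>, which is also the entry of \<open>M_tilde\<close> in those two positions.
  It is its own inverse.\<close>

definition idx_sign :: "idx \<Rightarrow> complex" where
  "idx_sign a = (-1) ^ nat \<bar>ival a\<bar>"

lemma idx_sign_uminus [simp]: "idx_sign (- a) = idx_sign a"
  by (simp add: idx_sign_def)

lemma idx_sign_simps [simp]: "idx_sign (Pos k) = (-1) ^ k" "idx_sign (Neg k) = (-1) ^ k"
  by (simp_all add: idx_sign_def)

lemma idx_sign_square [simp]: "idx_sign a * idx_sign a = 1" "idx_sign a * (idx_sign a * c) = c"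
  by (simp_all add: idx_sign_def flip: mult.assoc power_add)

lemma idx_sign_nonzero [simp]: "idx_sign a \<noteq> 0"
  by (simp add: idx_sign_def)

lemma uminus_in_I_set [simp]: "- a \<in> I_set lam \<longleftrightarrow> a \<notin> I_set lam"
  by (cases a) (auto simp: I_set_def)

lemma I_set_abs_inj:
  assumes "a \<in> I_set lam" "b \<in> I_set lam" "\<bar>ival a\<bar> = \<bar>ival b\<bar>"
  shows "a = b"
  using assms by (cases a; cases b) (auto simp: I_set_def)

lemma I_set_bounded_below: "\<exists>m. \<forall>a\<in>I_set lam. m \<le> a"
proof -
  obtain n where "\<forall>k\<in>set (even_parts lam). k \<le> n"
    using finite_nat_set_iff_bounded_le by blast
  then have "\<forall>a\<in>I_set lam. Neg n \<le> a"
    by (auto simp: I_set_def)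
  then show ?thesis ..
qed

definition I_zero :: "nat list \<Rightarrow> idx" where
  "I_zero lam = (if Neg 0 \<in> I_set lam then Neg 0 else Pos 0)"

lemma I_zero_in [simp]: "I_zero lam \<in> I_set lam"
  using uminus_in_I_set[of "Pos 0"] by (auto simp: I_zero_def)

lemma uminus_eq_I_zero_iff [simp]: "- a = I_zero lam \<longleftrightarrow> a = - I_zero lam"
  by (metis uminus_uminus_idx)

lemma ival_I_zero [simp]: "ival (I_zero lam) = 0"
  by (simp add: I_zero_def)

lemma idx_sign_I_zero [simp]: "idx_sign (I_zero lam) = 1"
  by (simp add: idx_sign_def)

lemma I_set_ival_eq_0_iff: "a \<in> I_set lam \<Longrightarrow> ival a = 0 \<longleftrightarrow> a = I_zero lam"
  by (metis I_set_abs_inj I_zero_in ival_I_zero)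

lemma ival_eq_0_iff: "ival a = 0 \<longleftrightarrow> a = I_zero lam \<or> a = - I_zero lam"
  by (cases a) (auto simp: I_zero_def)

section \<open>Finite supports and the quadratic form\<close>

text \<open>The labels \<open>- j\<close> with \<open>j\<close> in \<open>I_set lam\<close> are
  bounded above, while \<open>x\<close> vanishes far below, so only a finite interval of labels
  remains. This makes \<open>Q_tilde\<close> a finite sum on \<open>V_hat\<close>.\<close>

lemma finite_support_V_hat:
  assumes "x \<in> V_hat"
  shows "finite {j \<in> I_set lam. x (- j) \<noteq> 0}"
proof -
  obtain m where m: "\<forall>a<m. x a = 0"
    using assms by (auto simp: V_hat_def)
  obtain l where l: "\<forall>a\<in>I_set lam. l \<le> a"
    using I_set_bounded_below by blast
  have "{j \<in> I_set lam. x (- j) \<noteq> 0} \<subseteq> {a. l \<le> a \<and> a \<le> - m}"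
  proof clarify
    fix j assume j: "j \<in> I_set lam" "x (- j) \<noteq> 0"
    then have "m \<le> - j"
      using m not_less by blast
    then have "j \<le> - m"
      by (cases j; cases m) auto
    then show "l \<le> j \<and> j \<le> - m"
      using l j by blast
  qed
  then show ?thesis
    by (rule finite_subset) (rule finite_idx_interval)
qed

lemma infsum_finite_support:
  assumes "finite F" "F \<subseteq> A" "\<And>x. x \<in> A - F \<Longrightarrow> f x = 0"
  shows "infsum f A = sum f F"
proof -
  have "infsum f A = infsum f F"
    by (rule infsum_cong_neutral) (use assms in auto)
  then show ?thesis
    using assms(1) by simp
qed

text \<open>
  Each pair of opposite indices \<open>+k\<close>, \<open>-k\<close> has exactly one member in \<open>I_set lam\<close>, so the
  form may be summed over that set instead of over \<open>k\<close>.
\<close>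

lemma Q_tilde_I_set:
  assumes "finite F" "{j \<in> I_set lam. x (- j) \<noteq> 0} \<subseteq> F" "F \<subseteq> I_set lam"
  shows "Q_tilde x = (\<Sum>j\<in>F. idx_sign j * x j * x (- j))"
proof -
  have bij: "bij_betw (\<lambda>j. nat \<bar>ival j\<bar>) (I_set lam) UNIV"
    unfolding bij_betw_def
  proof
    show "inj_on (\<lambda>j. nat \<bar>ival j\<bar>) (I_set lam)"
      by (rule inj_onI) (auto intro: I_set_abs_inj)
    have "k \<in> (\<lambda>j. nat \<bar>ival j\<bar>) ` I_set lam" for k
    proof (cases "Pos k \<in> I_set lam")
      case True
      then show ?thesis by (rule rev_image_eqI) simp
    next
      case False
      then have "Neg k \<in> I_set lam"
        using uminus_in_I_set[of "Pos k"] by simp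
      then show ?thesis by (rule rev_image_eqI) simp
    qed
    then show "(\<lambda>j. nat \<bar>ival j\<bar>) ` I_set lam = UNIV"
      by blast
  qed
  have "Q_tilde x = (\<Sum>\<^sub>\<infinity>j\<in>I_set lam. (\<lambda>k. (-1) ^ k * x (Pos k) * x (Neg k)) (nat \<bar>ival j\<bar>))"
    unfolding Q_tilde_def by (rule infsum_reindex_bij_betw[OF bij, symmetric])
  also have "\<dots> = (\<Sum>\<^sub>\<infinity>j\<in>I_set lam. idx_sign j * x j * x (- j))"
  proof (rule infsum_cong)
    fix j
    show "(\<lambda>k. (-1) ^ k * x (Pos k) * x (Neg k)) (nat \<bar>ival j\<bar>) = idx_sign j * x j * x (- j)"
      by (cases j) simp_all
  qed
  also have "\<dots> = (\<Sum>j\<in>F. idx_sign j * x j * x (- j))"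
    by (rule infsum_finite_support) (use assms in auto)
  finally show ?thesis .
qed

section \<open>Matrices acting on vectors of finite support\<close>

lemma mat_vec_finite_support:
  assumes "finite F" "\<And>b. b \<notin> F \<Longrightarrow> N a b = 0 \<or> x b = 0"
  shows "mat_vec N x a = (\<Sum>b\<in>F. N a b * x b)"
  unfolding mat_vec_def by (rule infsum_finite_support) (use assms in auto)

lemma mat_vec_unit_vec: "mat_vec N (unit_vec b) = mat_col N b"
proof
  fix a
  have "mat_vec N (unit_vec b) a = (\<Sum>c\<in>{b}. N a c * unit_vec b c)"
    by (rule mat_vec_finite_support) (auto simp: unit_vec_def)
  then show "mat_vec N (unit_vec b) a = mat_col N b a"
    by (simp add: unit_vec_def mat_col_def)
qed

lemma mat_vec_add:
  assumes "finite {b. x b \<noteq> 0}" "finite {b. y b \<noteq> 0}"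
  shows "mat_vec N (x + y) = mat_vec N x + mat_vec N y"
proof
  fix a
  let ?F = "{b. x b \<noteq> 0} \<union> {b. y b \<noteq> 0}"
  have eq: "mat_vec N z a = (\<Sum>b\<in>?F. N a b * z b)" if "\<And>b. b \<notin> ?F \<Longrightarrow> z b = 0" for z
    by (rule mat_vec_finite_support) (use assms that in auto)
  have "mat_vec N (x + y) a = (\<Sum>b\<in>?F. N a b * (x + y) b)" by (rule eq) auto
  moreover have "mat_vec N x a = (\<Sum>b\<in>?F. N a b * x b)" by (rule eq) auto
  moreover have "mat_vec N y a = (\<Sum>b\<in>?F. N a b * y b)" by (rule eq) auto
  ultimately show "mat_vec N (x + y) a = (mat_vec N x + mat_vec N y) a"
    by (simp add: sum.distrib algebra_simps)
qed

text \<open>A nonzero factor changes neither summability nor its failure, and \<open>infsum\<close>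
  is 0 for a family that is not summable, so the identity holds for every \<open>x\<close>.\<close>

lemma mat_vec_cscale: "mat_vec N (cscale c x) = cscale c (mat_vec N x)"
proof
  fix a
  have "(\<Sum>\<^sub>\<infinity>b. N a b * (c * x b)) = (\<Sum>\<^sub>\<infinity>b. c * (N a b * x b))"
    by (simp add: algebra_simps)
  also have "\<dots> = c * (\<Sum>\<^sub>\<infinity>b. N a b * x b)"
    by (cases "c = 0") (simp_all add: infsum_cmult_right')
  finally show "mat_vec N (cscale c x) a = cscale c (mat_vec N x) a"
    by (simp add: mat_vec_def cscale_def)
qed

lemma span_unit_vec_support:
  assumes "x \<in> cvec.span (unit_vec ` K)"
  shows "finite {b. x b \<noteq> 0} \<and> (\<forall>b. b \<notin> K \<longrightarrow> x b = 0)"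
  using assms
proof (induction rule: cvec.span_induct_alt)
  case base
  then show ?case by simp
next
  case (step c u v)
  then obtain k where k: "k \<in> K" "u = unit_vec k"
    by blast
  have "{b. (cscale c u + v) b \<noteq> 0} \<subseteq> insert k {b. v b \<noteq> 0}"
    by (auto simp: k cscale_def unit_vec_def)
  then have "finite {b. (cscale c u + v) b \<noteq> 0}"
    by (rule finite_subset) (use step in simp)
  moreover have "(cscale c u + v) b = 0" if "b \<notin> K" for b
    using step k that by (auto simp: cscale_def unit_vec_def)
  ultimately show ?case
    by blast
qed

lemma mat_vec_span_unit_vec:
  "mat_vec N ` cvec.span (unit_vec ` K) = cvec.span (mat_col N ` K)"
proof
  show "mat_vec N ` cvec.span (unit_vec ` K) \<subseteq> cvec.span (mat_col N ` K)"
  proof clarify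
    fix x assume "x \<in> cvec.span (unit_vec ` K)"
    \<comment> \<open>Membership of \<open>x\<close> in the span is carried through the induction
      because it yields the finite support that \<open>mat_vec_add\<close> asks for.\<close>
    then have "mat_vec N x \<in> cvec.span (mat_col N ` K) \<and> x \<in> cvec.span (unit_vec ` K)"
    proof (induction rule: cvec.span_induct_alt)
      case base
      have "mat_vec N 0 = 0"
        by (simp add: mat_vec_def fun_eq_iff)
      then show ?case by (metis cvec.span_zero)
    next
      case (step c u v)
      then obtain k where k: "k \<in> K" "u = unit_vec k"
        by blast
      have cu: "cscale c u \<in> cvec.span (unit_vec ` K)"
        using step by (intro cvec.span_scale cvec.span_base)
      then have "mat_vec N (cscale c u + v) = cscale c (mat_col N k) + mat_vec N v"
        using step span_unit_vec_support
        by (subst mat_vec_add) (auto simp: mat_vec_cscale k mat_vec_unit_vec)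
      moreover have "\<dots> \<in> cvec.span (mat_col N ` K)"
        using step k by (intro cvec.span_add cvec.span_scale) (auto intro: cvec.span_base)
      moreover have "cscale c u + v \<in> cvec.span (unit_vec ` K)"
        using cu step by (intro cvec.span_add) blast+
      ultimately show ?case
        by (simp only:)
    qed
    then show "mat_vec N x \<in> cvec.span (mat_col N ` K)" ..
  qed
next
  have "cvec.subspace (mat_vec N ` cvec.span (unit_vec ` K))"
    unfolding cvec.subspace_def
  proof (intro conjI ballI allI)
    have "mat_vec N 0 = 0"
      by (simp add: mat_vec_def fun_eq_iff)
    then show "0 \<in> mat_vec N ` cvec.span (unit_vec ` K)"
      by (metis cvec.span_zero imageI)
  next
    fix x y assume "x \<in> mat_vec N ` cvec.span (unit_vec ` K)" "y \<in> mat_vec N ` cvec.span (unit_vec ` K)"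
    then obtain u v where "u \<in> cvec.span (unit_vec ` K)" "v \<in> cvec.span (unit_vec ` K)"
      "x = mat_vec N u" "y = mat_vec N v"
      by blast
    then have "x + y = mat_vec N (u + v)" "u + v \<in> cvec.span (unit_vec ` K)"
      using span_unit_vec_support by (auto simp: mat_vec_add intro: cvec.span_add)
    then show "x + y \<in> mat_vec N ` cvec.span (unit_vec ` K)"
      by blast
  next
    fix c x assume "x \<in> mat_vec N ` cvec.span (unit_vec ` K)"
    then show "cscale c x \<in> mat_vec N ` cvec.span (unit_vec ` K)"
      by (auto simp flip: mat_vec_cscale intro: cvec.span_scale)
  qed
  moreover have "mat_col N ` K \<subseteq> mat_vec N ` cvec.span (unit_vec ` K)"
    by (auto simp flip: mat_vec_unit_vec intro: cvec.span_base)
  ultimately show "cvec.span (mat_col N ` K) \<subseteq> mat_vec N ` cvec.span (unit_vec ` K)"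
    by (intro cvec.span_minimal)
qed

section \<open>Reduced echelon bases\<close>

text \<open>Elimination proceeds from the top labels downwards, by induction on the number of labels
  of \<open>K\<close> above \<open>k\<close>. Each vector is corrected by finitely many already
  reduced ones, so no infinite combination arises.\<close>

lemma echelon_reduction:
  fixes f :: "idx \<Rightarrow> cvec"
  assumes fin: "\<And>k. finite {l \<in> K. k < l}"
    and lead: "\<And>k. k \<in> K \<Longrightarrow> f k k = 1"
    and lower: "\<And>k a. k \<in> K \<Longrightarrow> a < k \<Longrightarrow> f k a = 0"
  shows "\<exists>g. cvec.span (g ` K) = cvec.span (f ` K) \<and>
    (\<forall>k\<in>K. g k k = 1 \<and> (\<forall>a<k. g k a = 0) \<and> (\<forall>l\<in>K. l \<noteq> k \<longrightarrow> g k l = 0))"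
proof -
  \<comment> \<open>The last conjunct records that the change from \<open>f\<close> to
    \<open>g\<close> is unitriangular, which is what makes it invertible and keeps the span.\<close>
  define red where "red k g \<longleftrightarrow> g k = 1 \<and> (\<forall>a<k. g a = 0) \<and> (\<forall>l\<in>K. l \<noteq> k \<longrightarrow> g l = 0)
    \<and> f k - g \<in> cvec.span (f ` {l \<in> K. k < l})" for k g
  have decr: "card {m \<in> K. l < m} < card {m \<in> K. k < m}" if "l \<in> K" "k < l" for k l
    using that fin by (intro psubset_card_mono) auto
  have mono: "cvec.span (f ` {m \<in> K. l < m}) \<subseteq> cvec.span (f ` {m \<in> K. k < m})" if "k < l" for k l
    using that by (intro cvec.span_mono) auto
  have "\<exists>g. red k g" if "k \<in> K" for k
    using that
  proof (induction "card {m \<in> K. k < m}" arbitrary: k rule: less_induct)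
    case less
    let ?T = "{l \<in> K. k < l}"
    have "\<forall>l\<in>?T. \<exists>g. red l g"
      using less decr by auto
    then obtain h where h: "\<And>l. l \<in> ?T \<Longrightarrow> red l (h l)"
      by metis
    \<comment> \<open>The coefficients can be read off from \<open>f k\<close> directly:
      \<open>h l\<close> is 1 at \<open>l\<close> and 0 at all other labels of \<open>K\<close>, so
      \<open>d\<close> agrees with \<open>f k\<close> on the labels of \<open>K\<close> above
      \<open>k\<close>.\<close>
    define d where "d = (\<Sum>l\<in>?T. cscale (f k l) (h l))"
    have d_at: "d a = (\<Sum>l\<in>?T. f k l * h l a)" for a
    proof -
      have "(\<Sum>l\<in>T. cscale (f k l) (h l)) a = (\<Sum>l\<in>T. f k l * h l a)" for T
        by (induction T rule: infinite_finite_induct) (simp_all add: cscale_def)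
      then show ?thesis by (simp add: d_def)
    qed
    have "h l \<in> cvec.span (f ` ?T)" if "l \<in> ?T" for l
    proof -
      have "f l - h l \<in> cvec.span (f ` ?T)"
        using h[OF that] that mono[of k l] by (auto simp: red_def)
      moreover have "f l \<in> cvec.span (f ` ?T)"
        using that by (intro cvec.span_base) auto
      ultimately have "f l - (f l - h l) \<in> cvec.span (f ` ?T)"
        by (rule cvec.span_diff[rotated])
      then show ?thesis by (simp only: diff_diff_eq2 add_diff_cancel_left')
    qed
    then have "d \<in> cvec.span (f ` ?T)"
      unfolding d_def by (intro cvec.span_sum cvec.span_scale)
    moreover have d_le: "d a = 0" if "a \<le> k" for a
      unfolding d_at using h that by (intro sum.neutral) (auto simp: red_def)
    moreover have d_T: "d m = f k m" if "m \<in> ?T" for m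
    proof -
      have "d m = (\<Sum>l\<in>?T. if l = m then f k l else 0)"
        unfolding d_at using h that by (intro sum.cong) (auto simp: red_def)
      then show ?thesis
        using that fin[of k] by simp
    qed
    moreover have "(f k - d) l = 0" if "l \<in> K" "l \<noteq> k" for l
      using that d_le[of l] d_T[of l] lower[OF less.prems] by (cases l k rule: linorder_cases) simp_all
    moreover have "f k - (f k - d) = d"
      by simp
    ultimately have "red k (f k - d)"
      using lead[OF less.prems] lower[OF less.prems] unfolding red_def by simp
    then show ?case by blast
  qed
  then obtain g where g: "\<And>k. k \<in> K \<Longrightarrow> red k (g k)"
    by metis
  \<comment> \<open>The unitriangular change is inverted by the same induction from the top.\<close>
  have "f k \<in> cvec.span (g ` K)" if "k \<in> K" for k
    using that
  proof (induction "card {m \<in> K. k < m}" arbitrary: k rule: less_induct)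
    case less
    have "f ` {m \<in> K. k < m} \<subseteq> cvec.span (g ` K)"
      using less decr by blast
    then have "f k - g k \<in> cvec.span (g ` K)"
      using g[OF less.prems] cvec.span_minimal[OF _ cvec.subspace_span] unfolding red_def by blast
    moreover have "g k \<in> cvec.span (g ` K)"
      using less.prems by (intro cvec.span_base) auto
    ultimately have "(f k - g k) + g k \<in> cvec.span (g ` K)"
      by (rule cvec.span_add)
    then show ?case by simp
  qed
  moreover have "g k \<in> cvec.span (f ` K)" if "k \<in> K" for k
  proof -
    have "f k - g k \<in> cvec.span (f ` K)"
      using g[OF that] cvec.span_mono[of "f ` {m \<in> K. k < m}" "f ` K"] by (auto simp: red_def)
    moreover have "f k \<in> cvec.span (f ` K)"
      using that by (intro cvec.span_base) auto
    ultimately have "f k - (f k - g k) \<in> cvec.span (f ` K)"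
      by (rule cvec.span_diff[rotated])
    then show ?thesis by (simp only: diff_diff_eq2 add_diff_cancel_left')
  qed
  ultimately have "cvec.span (g ` K) = cvec.span (f ` K)"
    by (intro subset_antisym cvec.span_minimal cvec.subspace_span) auto
  then show ?thesis
    using g unfolding red_def by blast
qed

section \<open>The skew matrix of \<open>r\<close> and the columns of \<open>L_mat\<close>\<close>

text \<open>The skew matrix \<open>S\<close> that \<open>r\<close> determines. On
  \<open>I_set lam\<close> it vanishes on the diagonal and wherever the index of larger absolute
  value is negative, that is for \<open>i < - j\<close>; these are the zeros that lower
  triangularity imposes on a column with leading entry at \<open>- j\<close>.\<close>

definition skew_entry :: "(int \<times> int \<Rightarrow> complex) \<Rightarrow> idx \<Rightarrow> idx \<Rightarrow> complex" where
  "skew_entry r i j =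
     (if ival i > \<bar>ival j\<bar> then r (ival i, ival j)
      else if ival j > \<bar>ival i\<bar> then - r (ival j, ival i) else 0)"

lemma skew_entry_skew: "skew_entry r i j = - skew_entry r j i"
  by (auto simp: skew_entry_def)

definition zero_coeff :: "(int \<times> int \<Rightarrow> complex) \<Rightarrow> idx \<Rightarrow> complex" where
  "zero_coeff r i = (if ival i > 0 then r (ival i, 0) else 0)"

lemma skew_entry_I_zero:
  "skew_entry r i (I_zero lam) = zero_coeff r i"
  "skew_entry r (I_zero lam) i = - zero_coeff r i"
  by (auto simp: skew_entry_def zero_coeff_def)

lemma zero_coeff_I_zero [simp]: "zero_coeff r (I_zero lam) = 0"
  by (simp add: zero_coeff_def)

text \<open>
  The columns of \<open>L_mat\<close> after elimination of the entry at \<open>- I_zero lam\<close>, which is caused by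
  \<open>E\<^sub>0\<^sub>,\<^sub>i\<close>. Adding \<open>r\<^sub>j\<^sub>,\<^sub>0\<close> times column \<open>0\<close> to column \<open>j\<close> removes it and cancels the quadratic term.
\<close>

definition reduced_col :: "nat list \<Rightarrow> (int \<times> int \<Rightarrow> complex) \<Rightarrow> idx \<Rightarrow> cvec" where
  "reduced_col lam r j = (\<lambda>a. if a = - j then idx_sign j else if a \<in> I_set lam then skew_entry r a j else 0)"

lemma M_tilde_eq: "M_tilde a b = (if a = - b then idx_sign b else 0)"
proof -
  have "M_tilde a b = (\<Sum>k\<in>{nat \<bar>ival b\<bar>}.
      (-1) ^ k * (mat_unit (Pos k) (Neg k) a b + mat_unit (Neg k) (Pos k) a b))"
    unfolding M_tilde_def by (rule infsum_finite_support) (auto simp: mat_unit_def)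
  also have "\<dots> = (if a = - b then idx_sign b else 0)"
    by (cases b) (auto simp: mat_unit_def)
  finally show ?thesis .
qed

lemma E_mat_apply:
  assumes "ival i \<noteq> 0"
  shows "E_mat i j a b = (if a = i \<and> (b = j \<or> ival b = 0 \<and> ival j = 0) then 1 else 0)"
    and "E_mat j i a b = (if b = i \<and> (a = j \<or> ival a = 0 \<and> ival j = 0) then 1 else 0)"
proof -
  show "E_mat i j a b = (if a = i \<and> (b = j \<or> ival b = 0 \<and> ival j = 0) then 1 else 0)"
  proof (cases "ival j = 0")
    case True
    then have "E_mat i j a b = mat_unit i (Pos 0) a b + mat_unit i (Neg 0) a b"
      using assms by (simp add: E_mat_def)
    then show ?thesis
      using True by (cases b) (auto simp: mat_unit_def)
  qed (simp add: E_mat_def mat_unit_def assms)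
  show "E_mat j i a b = (if b = i \<and> (a = j \<or> ival a = 0 \<and> ival j = 0) then 1 else 0)"
  proof (cases "ival j = 0")
    case True
    then have "E_mat j i a b = mat_unit (Pos 0) i a b + mat_unit (Neg 0) i a b"
      by (simp add: E_mat_def)
    then show ?thesis
      using True by (cases a) (auto simp: mat_unit_def)
  qed (auto simp: E_mat_def mat_unit_def assms)
qed

text \<open>In a fixed entry, each formal sum reduces to at most one pair of indices. The quadratic
  term is then \<open>zero_coeff r b\<close> times the part of column \<open>I_zero lam\<close> with
  rows in \<open>I_set lam\<close>, and the extra entry from \<open>E_mat\<close> in row
  \<open>- I_zero lam\<close> matches the leading entry of that same column.\<close>

lemma L_mat_col:
  assumes b: "b \<in> I_set lam"
  shows "mat_col (L_mat lam r) b =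
    reduced_col lam r b - cscale (zero_coeff r b) (reduced_col lam r (I_zero lam))"
proof
  fix a
  let ?o = "I_zero lam"
  \<comment> \<open>A matrix \<open>E_mat\<close> with a zero row index has entries in both zero
    rows, so both are identified with the zero that occurs in \<open>I_set lam\<close>.\<close>
  define a' where "a' = (if ival a = 0 then ?o else a)"
  have E1: "E_mat i j a b = (if (i, j) = (a', b) then 1 else 0)"
    if "i \<in> I_set lam" "j \<in> I_set lam" "ival i > 0" for i j
  proof -
    have "a = i \<longleftrightarrow> i = a'"
      using that by (auto simp: a'_def)
    moreover have "b = j \<or> ival b = 0 \<and> ival j = 0 \<longleftrightarrow> j = b"
      using that b I_set_abs_inj by auto
    ultimately show ?thesis
      using that by (simp add: E_mat_apply)
  qed
  have E2: "E_mat j i a b = (if (i, j) = (b, a') then 1 else 0)"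
    if "i \<in> I_set lam" "j \<in> I_set lam" "ival i > 0" for i j
  proof -
    have "a = j \<or> ival a = 0 \<and> ival j = 0 \<longleftrightarrow> j = a'"
      using that I_set_ival_eq_0_iff[of j lam] by (auto simp: a'_def)
    then show ?thesis
      using that by (auto simp: E_mat_apply)
  qed
  let ?P = "idx_pairs lam"
  have pos: "ival i > 0" "i \<in> I_set lam" "j \<in> I_set lam" if "(i, j) \<in> ?P" for i j
    using that by (auto simp: idx_pairs_def)
  have "(\<Sum>\<^sub>\<infinity>(i, j)\<in>?P. r (ival i, ival j) * (E_mat i j a b - E_mat j i a b))
    = (\<Sum>(i, j)\<in>?P \<inter> {(a', b), (b, a')}. r (ival i, ival j) * (E_mat i j a b - E_mat j i a b))"
    by (rule infsum_finite_support) (auto simp: E1 E2 pos split: if_splits)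
  also have "\<dots> = (\<Sum>(i, j)\<in>?P \<inter> {(a', b), (b, a')}. r (ival i, ival j) *
      ((if (i, j) = (a', b) then 1 else 0) - (if (i, j) = (b, a') then 1 else 0)))"
    by (rule sum.cong) (auto simp: E1 E2 pos)
  also have "\<dots> = (if a' \<in> I_set lam then skew_entry r a' b else 0)"
  proof -
    consider "(a', b) \<in> ?P" | "(b, a') \<in> ?P" | "(a', b) \<notin> ?P" "(b, a') \<notin> ?P"
      by blast
    then show ?thesis
    proof cases
      case 1
      then have eq: "?P \<inter> {(a', b), (b, a')} = {(a', b)}" "a' \<noteq> b"
        by (auto simp: idx_pairs_def)
      show ?thesis
        unfolding eq using 1 eq(2) by (simp add: idx_pairs_def skew_entry_def)
    next
      case 2
      then have eq: "?P \<inter> {(a', b), (b, a')} = {(b, a')}" "a' \<noteq> b"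
        by (auto simp: idx_pairs_def)
      show ?thesis
        unfolding eq using 2 eq(2) by (auto simp: idx_pairs_def skew_entry_def)
    next
      case 3
      then have eq: "?P \<inter> {(a', b), (b, a')} = {}"
        by blast
      show ?thesis
        unfolding eq using 3 b by (simp add: idx_pairs_def skew_entry_def)
    qed
  qed
  finally have s1: "(\<Sum>\<^sub>\<infinity>(i, j)\<in>?P. r (ival i, ival j) * (E_mat i j a b - E_mat j i a b))
    = (if a' \<in> I_set lam then skew_entry r a' b else 0)" .
  let ?R = "{(i, j). i \<in> I_set lam \<and> j \<in> I_set lam \<and> ival i > 0 \<and> ival j > 0}"
  have "(\<Sum>\<^sub>\<infinity>(i, j)\<in>?R. r (ival i, 0) * r (ival j, 0) * E_mat i j a b)
    = (\<Sum>(i, j)\<in>?R \<inter> {(a', b)}. r (ival i, 0) * r (ival j, 0) * E_mat i j a b)"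
    by (rule infsum_finite_support) (auto simp: E1 split: if_splits)
  also have "\<dots> = (if a' \<in> I_set lam \<and> ival a' > 0 \<and> ival b > 0 then r (ival a', 0) * r (ival b, 0) else 0)"
  proof (cases "(a', b) \<in> ?R")
    case True
    then have eq: "?R \<inter> {(a', b)} = {(a', b)}"
      by blast
    show ?thesis
      unfolding eq using True by (simp add: E1)
  next
    case False
    then have eq: "?R \<inter> {(a', b)} = {}"
      by blast
    show ?thesis
      unfolding eq using False b by auto
  qed
  finally have s2: "(\<Sum>\<^sub>\<infinity>(i, j)\<in>?R. r (ival i, 0) * r (ival j, 0) * E_mat i j a b)
    = (if a' \<in> I_set lam \<and> ival a' > 0 \<and> ival b > 0 then r (ival a', 0) * r (ival b, 0) else 0)" .
  have L: "L_mat lam r a b = (if a = - b then idx_sign b else 0)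
    + (if a' \<in> I_set lam then skew_entry r a' b else 0)
    - (if a' \<in> I_set lam then zero_coeff r a' * zero_coeff r b else 0)"
    unfolding L_mat_def s1 s2 M_tilde_eq by (simp add: zero_coeff_def)
  \<comment> \<open>Row \<open>- ?o\<close> is separated because it is the one row outside
    \<open>I_set lam\<close>, apart from row \<open>- b\<close>, in which the column can be
    nonzero.\<close>
  consider "a \<in> I_set lam" | "a = - ?o" | "a \<notin> I_set lam" "ival a \<noteq> 0"
    using ival_eq_0_iff[of a lam] I_zero_in by blast
  then show "mat_col (L_mat lam r) b a = (reduced_col lam r b
    - cscale (zero_coeff r b) (reduced_col lam r ?o)) a"
  proof cases
    case 1
    then have "a' = a" "a \<noteq> - b" "a \<noteq> - ?o"
      using b I_set_ival_eq_0_iff[of a lam] by (auto simp: a'_def)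
    then show ?thesis
      unfolding mat_col_def L using 1 by (simp add: reduced_col_def cscale_def skew_entry_I_zero)
  next
    case 2
    then have a: "a' = ?o" "a \<notin> I_set lam"
      by (auto simp: a'_def)
    show ?thesis
    proof (cases "b = ?o")
      case True
      then show ?thesis
        unfolding mat_col_def L using 2 a by (simp add: reduced_col_def cscale_def skew_entry_I_zero)
    next
      case False
      then have "a \<noteq> - b"
        using 2 by simp
      then show ?thesis
        unfolding mat_col_def L using 2 a by (simp add: reduced_col_def cscale_def skew_entry_I_zero)
    qed
  next
    case 3
    then have "a' = a" "a \<noteq> - ?o"
      by (auto simp: a'_def)
    then show ?thesis
      unfolding mat_col_def L using 3 by (simp add: reduced_col_def cscale_def)
  qed
qed

text \<open>Column \<open>I_zero lam\<close> is the same in both families since its own coefficient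
  is 0. Hence the column operation is undone by adding back the same multiple of it.\<close>

lemma column_span_eq: "column_span lam r = cvec.span (reduced_col lam r ` I_set lam)"
proof -
  let ?o = "I_zero lam" and ?L = "\<lambda>j. mat_col (L_mat lam r) j" and ?G = "reduced_col lam r"
  have G: "?G j \<in> cvec.span (?G ` I_set lam)" and L: "?L j \<in> cvec.span (?L ` I_set lam)"
    if "j \<in> I_set lam" for j
    using that by (simp_all add: cvec.span_base)
  have L_zero: "?L ?o = ?G ?o"
    using L_mat_col[OF I_zero_in, of lam r] by (simp add: fun_eq_iff cscale_def)
  have "?L j \<in> cvec.span (?G ` I_set lam)" if "j \<in> I_set lam" for j
    unfolding L_mat_col[OF that] by (rule cvec.span_diff[OF G[OF that] cvec.span_scale[OF G[OF I_zero_in]]])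
  moreover have "?G j \<in> cvec.span (?L ` I_set lam)" if "j \<in> I_set lam" for j
  proof -
    have "?G j = ?L j + cscale (zero_coeff r j) (?L ?o)"
      unfolding L_zero L_mat_col[OF that] by (simp only: diff_add_cancel)
    then show ?thesis
      using cvec.span_add[OF L[OF that] cvec.span_scale[OF L[OF I_zero_in]]] by (simp only:)
  qed
  ultimately have "cvec.span (?L ` I_set lam) = cvec.span (?G ` I_set lam)"
    by (intro subset_antisym cvec.span_minimal cvec.subspace_span) auto
  moreover have "{mat_col (L_mat lam r) j | j. j \<in> I_set lam} = ?L ` I_set lam"
    by blast
  ultimately show ?thesis
    by (simp add: column_span_def)
qed

lemma idx_uminus_le_iff: "- a \<le> - b \<longleftrightarrow> b \<le> (a :: idx)"
  by (cases a; cases b) auto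

lemma reduced_col_simps:
  assumes "i \<in> I_set lam" "j \<in> I_set lam"
  shows "reduced_col lam r j (- i) = (if i = j then idx_sign j else 0)"
    and "reduced_col lam r j i = skew_entry r i j"
  using assms by (auto simp: reduced_col_def)

section \<open>Injectivity\<close>

text \<open>Among the reduced columns only column \<open>i\<close> meets row \<open>- i\<close>,
  with entry \<open>idx_sign i\<close>. So the coefficient of that column in \<open>v\<close> is
  \<open>idx_sign i * v (- i)\<close>, and the span is the graph of \<open>S\<close> over the
  coordinates outside \<open>I_set lam\<close>.\<close>

lemma span_reduced_col_expansion:
  assumes "v \<in> cvec.span (reduced_col lam r ` I_set lam)"
  shows "\<exists>F. finite F \<and> F \<subseteq> I_set lam \<and> (\<forall>i\<in>I_set lam - F. v (- i) = 0)
    \<and> (\<forall>a\<in>I_set lam. v a = (\<Sum>i\<in>F. idx_sign i * v (- i) * skew_entry r a i))"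
  using assms
proof (induction rule: cvec.span_induct_alt)
  case base
  then show ?case
    by (intro exI[of _ "{}"]) simp
next
  case (step c u v)
  then obtain k where k: "k \<in> I_set lam" "u = reduced_col lam r k"
    by blast
  from step obtain F where F: "finite F" "F \<subseteq> I_set lam" "\<And>i. i \<in> I_set lam - F \<Longrightarrow> v (- i) = 0"
    "\<And>a. a \<in> I_set lam \<Longrightarrow> v a = (\<Sum>i\<in>F. idx_sign i * v (- i) * skew_entry r a i)"
    by blast
  let ?w = "cscale c u + v" and ?F = "insert k F"
  have w: "?w (- i) = (if i = k then c * idx_sign k else 0) + v (- i)" if "i \<in> I_set lam" for i
    using that k by (simp add: cscale_def reduced_col_simps)
  have "?w a = (\<Sum>i\<in>?F. idx_sign i * ?w (- i) * skew_entry r a i)" if a: "a \<in> I_set lam" for a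
  proof -
    have "(\<Sum>i\<in>?F. idx_sign i * ?w (- i) * skew_entry r a i)
      = (\<Sum>i\<in>?F. (if i = k then c * skew_entry r a k else 0) + idx_sign i * v (- i) * skew_entry r a i)"
    proof (rule sum.cong)
      fix i assume "i \<in> ?F"
      then have "i \<in> I_set lam" using k F by blast
      then show "idx_sign i * ?w (- i) * skew_entry r a i
        = (if i = k then c * skew_entry r a k else 0) + idx_sign i * v (- i) * skew_entry r a i"
        unfolding w[OF \<open>i \<in> I_set lam\<close>] by (simp add: algebra_simps)
    qed simp
    also have "\<dots> = c * skew_entry r a k + (\<Sum>i\<in>?F. idx_sign i * v (- i) * skew_entry r a i)"
      using F(1) by (simp only: sum.distrib) simp
    also have "(\<Sum>i\<in>?F. idx_sign i * v (- i) * skew_entry r a i)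
      = (\<Sum>i\<in>F. idx_sign i * v (- i) * skew_entry r a i)"
      using F k by (intro sum.mono_neutral_right) auto
    also have "\<dots> = v a"
      using F(4) a by simp
    finally show ?thesis
      using a k by (simp add: cscale_def reduced_col_simps)
  qed
  moreover have "\<forall>i\<in>I_set lam - ?F. ?w (- i) = 0"
    using w F(3) by simp
  moreover have "finite ?F" "?F \<subseteq> I_set lam"
    using F k by auto
  ultimately show ?case
    by blast
qed

text \<open>A reduced column of \<open>r'\<close> is expanded in the reduced columns of
  \<open>r\<close>. Its entries outside \<open>I_set lam\<close> leave only column \<open>j\<close>
  of \<open>r\<close>, so the entries inside compare the two skew matrices.\<close>

lemma column_span_inj: "inj_on (column_span lam) (r_families lam)"
proof (rule inj_onI)
  fix r r' assume r: "r \<in> r_families lam" "r' \<in> r_families lam"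
    and eq: "column_span lam r = column_span lam r'"
  have entry: "skew_entry r' a j = skew_entry r a j" if "a \<in> I_set lam" "j \<in> I_set lam" for a j
  proof -
    let ?v = "reduced_col lam r' j"
    have "?v \<in> cvec.span (reduced_col lam r' ` I_set lam)"
      using that by (intro cvec.span_base) blast
    then have "?v \<in> cvec.span (reduced_col lam r ` I_set lam)"
      using eq by (simp add: column_span_eq)
    then have "\<exists>F. finite F \<and> F \<subseteq> I_set lam \<and> (\<forall>i\<in>I_set lam - F. ?v (- i) = 0)
      \<and> (\<forall>a\<in>I_set lam. ?v a = (\<Sum>i\<in>F. idx_sign i * ?v (- i) * skew_entry r a i))"
      by (rule span_reduced_col_expansion)
    then obtain F where F: "finite F" "F \<subseteq> I_set lam" "\<forall>i\<in>I_set lam - F. ?v (- i) = 0"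
      "\<forall>a\<in>I_set lam. ?v a = (\<Sum>i\<in>F. idx_sign i * ?v (- i) * skew_entry r a i)"
      by (elim exE conjE) (rule that)
    have "j \<in> F"
      using bspec[OF F(3), of j] that by (auto simp: reduced_col_simps)
    have "?v a = (\<Sum>i\<in>F. if i = j then skew_entry r a j else 0)"
      unfolding bspec[OF F(4) that(1)]
    proof (rule sum.cong)
      fix i assume "i \<in> F"
      then show "idx_sign i * ?v (- i) * skew_entry r a i = (if i = j then skew_entry r a j else 0)"
        using F(2) that by (auto simp: reduced_col_simps)
    qed simp
    then show ?thesis
      using \<open>j \<in> F\<close> F(1) that by (simp add: reduced_col_simps)
  qed
  show "r = r'"
  proof (rule PiE_ext)
    show "r \<in> {(ival i, ival j) | i j. (i, j) \<in> idx_pairs lam} \<rightarrow>\<^sub>E UNIV"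
      "r' \<in> {(ival i, ival j) | i j. (i, j) \<in> idx_pairs lam} \<rightarrow>\<^sub>E UNIV"
      using r by (simp_all add: r_families_def)
    fix p assume "p \<in> {(ival i, ival j) | i j. (i, j) \<in> idx_pairs lam}"
    then obtain i j where "p = (ival i, ival j)" "i \<in> I_set lam" "j \<in> I_set lam" "ival i > \<bar>ival j\<bar>"
      by (auto simp: idx_pairs_def)
    then show "r p = r' p"
      using entry[of i j] by (simp add: skew_entry_def)
  qed
qed

section \<open>Elements of the cell as column spans\<close>

lemma span_image_cscale:
  assumes "\<And>j. j \<in> J \<Longrightarrow> c j \<noteq> 0"
  shows "cvec.span ((\<lambda>j. cscale (c j) (f j)) ` J) = cvec.span (f ` J)"
proof (intro subset_antisym cvec.span_minimal cvec.subspace_span)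
  show "(\<lambda>j. cscale (c j) (f j)) ` J \<subseteq> cvec.span (f ` J)"
    by (auto intro!: cvec.span_scale intro: cvec.span_base)
  show "f ` J \<subseteq> cvec.span ((\<lambda>j. cscale (c j) (f j)) ` J)"
  proof clarify
    fix j assume j: "j \<in> J"
    have "cscale (inverse (c j)) (cscale (c j) (f j)) \<in> cvec.span ((\<lambda>j. cscale (c j) (f j)) ` J)"
      using j by (intro cvec.span_scale cvec.span_base) blast
    then show "f j \<in> cvec.span ((\<lambda>j. cscale (c j) (f j)) ` J)"
      using assms[OF j] by simp
  qed
qed

lemma U_space_eq: "U_space lam = cvec.span (unit_vec ` uminus ` I_set lam)"
  unfolding U_space_def by (rule arg_cong[of _ _ cvec.span]) auto

lemma uminus_image_I_set: "uminus ` I_set lam = - I_set lam"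
proof
  show "- I_set lam \<subseteq> uminus ` I_set lam"
  proof
    fix a assume "a \<in> - I_set lam"
    then have "- a \<in> I_set lam" by simp
    then show "a \<in> uminus ` I_set lam" by (metis imageI uminus_uminus_idx)
  qed
qed auto

text \<open>An element \<open>W\<close> of the cell inherits isotropy from
  \<open>U_space lam\<close>. For its reduced echelon basis, isotropy yields skewness and the
  triangular shape yields the remaining zeros of \<open>S\<close>.\<close>

lemma schubert_cell_subset: "schubert_cell lam \<subseteq> column_span lam ` r_families lam"
proof
  fix W assume "W \<in> schubert_cell lam"
  then obtain N where N: "N \<in> N_minus" "W = mat_vec N ` U_space lam"
    by (auto simp: schubert_cell_def)
  \<comment> \<open>Every product in \<open>Q_tilde u\<close> has a factor with label in
    \<open>I_set lam\<close>, where \<open>u\<close> vanishes. Membership of \<open>u\<close> in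
    \<open>V_hat\<close> is established because \<open>N\<close> is known to preserve the form only
    there.\<close>
  have isotropic: "Q_tilde w = 0" if w: "w \<in> W" for w
  proof -
    obtain u where u: "u \<in> U_space lam" "w = mat_vec N u"
      using w N by blast
    then have fin: "finite {b. u b \<noteq> 0}" and off: "\<And>b. b \<in> I_set lam \<Longrightarrow> u b = 0"
      using span_unit_vec_support[of u "- I_set lam"] by (auto simp: U_space_eq uminus_image_I_set)
    have "u \<in> V_hat"
    proof (cases "{b. u b \<noteq> 0} = {}")
      case True
      then show ?thesis by (auto simp: V_hat_def)
    next
      case False
      have "u a = 0" if "a < Min {b. u b \<noteq> 0}" for a
        using that Min_le[OF fin, of a] by fastforce
      then show ?thesis
        unfolding V_hat_def by blast
    qed
    moreover have "Q_tilde u = 0"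
      using Q_tilde_I_set[OF finite_support_V_hat[OF \<open>u \<in> V_hat\<close>, of lam] subset_refl] off
      by auto
    ultimately show ?thesis
      using N(1) u(2) by (simp add: N_minus_def)
  qed
  have fin: "finite {l \<in> - I_set lam. k < l}" for k
  proof -
    obtain m where m: "\<forall>a\<in>I_set lam. m \<le> a"
      using I_set_bounded_below by blast
    have "{l \<in> - I_set lam. k < l} \<subseteq> {a. k \<le> a \<and> a \<le> - m}"
    proof clarify
      fix l assume l: "l \<notin> I_set lam" "k < l"
      then have "- (- m) \<le> - l" using m by simp
      then show "k \<le> l \<and> l \<le> - m"
        using l unfolding idx_uminus_le_iff by simp
    qed
    then show ?thesis
      by (rule finite_subset) (rule finite_idx_interval)
  qed
  have "\<exists>g. cvec.span (g ` (- I_set lam)) = cvec.span (mat_col N ` (- I_set lam)) \<and>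
    (\<forall>k\<in>- I_set lam. g k k = 1 \<and> (\<forall>a<k. g k a = 0) \<and> (\<forall>l\<in>- I_set lam. l \<noteq> k \<longrightarrow> g k l = 0))"
    by (rule echelon_reduction[OF fin]) (use N(1) in \<open>auto simp: N_minus_def mat_col_def\<close>)
  then obtain g where span: "cvec.span (g ` (- I_set lam)) = cvec.span (mat_col N ` (- I_set lam))"
    and lead: "\<And>k. k \<in> - I_set lam \<Longrightarrow> g k k = 1"
    and lower: "\<And>k a. k \<in> - I_set lam \<Longrightarrow> a < k \<Longrightarrow> g k a = 0"
    and red: "\<And>k l. k \<in> - I_set lam \<Longrightarrow> l \<in> - I_set lam \<Longrightarrow> l \<noteq> k \<Longrightarrow> g k l = 0"
    by blast
  have W: "W = cvec.span (g ` (- I_set lam))"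
    using N(2) by (simp add: span U_space_eq uminus_image_I_set mat_vec_span_unit_vec)
  \<comment> \<open>The sign rescales the leading entry 1 of \<open>g (- j)\<close> to the entry
    \<open>idx_sign j\<close> of a reduced column.\<close>
  define T where "T i j = idx_sign j * g (- j) i" for i j
  have gW: "g (- j) \<in> W" if "j \<in> I_set lam" for j
    unfolding W using that by (intro cvec.span_base) simp
  have g_at: "g (- j) (- i) = (if i = j then 1 else 0)" if "i \<in> I_set lam" "j \<in> I_set lam" for i j
    using that lead[of "- j"] red[of "- j" "- i"] by auto
  have T_diag: "T j j = 0" if j: "j \<in> I_set lam" for j
  proof -
    have "Q_tilde (g (- j)) = (\<Sum>i\<in>{j}. idx_sign i * g (- j) i * g (- j) (- i))"
      by (rule Q_tilde_I_set[of _ lam]) (use j g_at in \<open>auto split: if_splits\<close>)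
    then show ?thesis
      using isotropic[OF gW[OF j]] j by (simp add: g_at T_def)
  qed
  have T_skew: "T i j = - T j i" if ij: "i \<in> I_set lam" "j \<in> I_set lam" for i j
  proof (cases "i = j")
    case True
    then show ?thesis using T_diag ij by simp
  next
    case False
    \<comment> \<open>Polarisation: the diagonal terms vanish by \<open>T_diag\<close>, so isotropy
      of the sum leaves the two cross terms.\<close>
    let ?w = "g (- i) + g (- j)"
    have "?w \<in> W"
      using gW[OF ij(1)] gW[OF ij(2)] unfolding W by (rule cvec.span_add)
    then have "0 = Q_tilde ?w"
      using isotropic by simp
    also have "\<dots> = (\<Sum>k\<in>{i, j}. idx_sign k * ?w k * ?w (- k))"
      by (rule Q_tilde_I_set[of _ lam]) (use ij g_at in \<open>auto split: if_splits\<close>)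
    also have "\<dots> = idx_sign i * g (- j) i + idx_sign j * g (- i) j"
      using False ij T_diag[OF ij(1)] T_diag[OF ij(2)] by (simp add: g_at T_def algebra_simps)
    finally have eq: "idx_sign i * g (- j) i = - (idx_sign j * g (- i) j)"
      by (simp add: eq_neg_iff_add_eq_0)
    have "T i j = idx_sign j * (idx_sign i * (idx_sign i * g (- j) i))"
      by (simp add: T_def)
    also have "\<dots> = - (idx_sign j * (idx_sign i * (idx_sign j * g (- i) j)))"
      by (simp only: eq mult_minus_right)
    also have "\<dots> = - (idx_sign j * (idx_sign j * (idx_sign i * g (- i) j)))"
      by (subst mult.left_commute[of "idx_sign i" "idx_sign j"]) (rule refl)
    also have "\<dots> = - T j i"
      by (simp add: T_def)
    finally show ?thesis .
  qed
  have T_zero: "T i j = 0" if "i \<in> I_set lam" "j \<in> I_set lam" "i < - j" for i j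
    using that lower[of "- j" i] by (simp add: T_def)
  \<comment> \<open>Families \<open>r\<close> are indexed by integers; \<open>num\<close> recovers
    the index in \<open>I_set lam\<close>, where \<open>ival\<close> is injective.\<close>
  define num where "num = inv_into (I_set lam) ival"
  define D where "D = {(ival i, ival j) | i j. (i, j) \<in> idx_pairs lam}"
  define r where "r = restrict (\<lambda>(m, n). T (num m) (num n)) D"
  have num: "num (ival i) = i" if "i \<in> I_set lam" for i
  proof -
    have "inj_on ival (I_set lam)"
      by (rule inj_onI) (auto intro: I_set_abs_inj)
    then show ?thesis
      using that by (simp add: num_def)
  qed
  have r_at: "r (ival i, ival j) = T i j" if "i \<in> I_set lam" "j \<in> I_set lam" "ival i > \<bar>ival j\<bar>" for i j
  proof -
    have "(ival i, ival j) \<in> D"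
      using that by (auto simp: D_def idx_pairs_def)
    then show ?thesis
      using that by (simp add: r_def num)
  qed
  have S: "skew_entry r i j = T i j" if ij: "i \<in> I_set lam" "j \<in> I_set lam" for i j
  proof -
    \<comment> \<open>Equal absolute values force \<open>i = j\<close> within
      \<open>I_set lam\<close>. In the last two cases the index of larger absolute value is
      negative, and \<open>T\<close> vanishes by triangularity, directly or after using
      skewness.\<close>
    consider "ival i > \<bar>ival j\<bar>" | "ival j > \<bar>ival i\<bar>" | "i = j" | "- ival i > \<bar>ival j\<bar>" | "- ival j > \<bar>ival i\<bar>"
      using I_set_abs_inj[OF ij] by linarith
    then show ?thesis
    proof cases
      case 1
      then show ?thesis using ij by (simp add: skew_entry_def r_at)
    next
      case 2
      then show ?thesis using ij T_skew[OF ij] by (simp add: skew_entry_def r_at)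
    next
      case 3
      then show ?thesis using ij T_diag by (simp add: skew_entry_def)
    next
      case 4
      then have "i < - j" by (cases i; cases j) auto
      then show ?thesis using 4 ij T_zero by (auto simp: skew_entry_def)
    next
      case 5
      then have "j < - i" by (cases i; cases j) auto
      then show ?thesis using 5 ij T_zero T_skew[OF ij] by (auto simp: skew_entry_def)
    qed
  qed
  have col: "reduced_col lam r j = cscale (idx_sign j) (g (- j))" if j: "j \<in> I_set lam" for j
  proof
    fix a
    show "reduced_col lam r j a = cscale (idx_sign j) (g (- j)) a"
    proof (cases "a \<in> I_set lam")
      case True
      then show ?thesis
        using j by (simp add: reduced_col_simps S cscale_def T_def)
    next
      case False
      then obtain i where "i \<in> I_set lam" "a = - i"
        by (metis uminus_in_I_set uminus_uminus_idx)
      then show ?thesis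
        using j by (simp add: reduced_col_simps cscale_def g_at)
    qed
  qed
  have "column_span lam r = cvec.span ((\<lambda>j. cscale (idx_sign j) (g (- j))) ` I_set lam)"
    unfolding column_span_eq using col by (intro arg_cong[of _ _ cvec.span] image_cong) auto
  also have "\<dots> = cvec.span ((\<lambda>j. g (- j)) ` I_set lam)"
    by (rule span_image_cscale) simp
  also have "(\<lambda>j. g (- j)) ` I_set lam = g ` (- I_set lam)"
    by (simp flip: uminus_image_I_set add: image_image)
  finally have "column_span lam r = W"
    by (simp add: W)
  moreover have "r \<in> r_families lam"
    by (simp add: r_families_def r_def D_def)
  ultimately show "W \<in> column_span lam ` r_families lam"
    by blast
qed

section \<open>Column spans as elements of the cell\<close>

lemma L_mat_entries:
  assumes "i \<in> I_set lam" "j \<in> I_set lam"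
  shows "L_mat lam r (- i) j = (if i = j then idx_sign j else 0) - (if i = I_zero lam then zero_coeff r j else 0)"
    and "L_mat lam r i j = skew_entry r i j - zero_coeff r j * zero_coeff r i"
proof -
  have eq: "L_mat lam r a j = reduced_col lam r j a - zero_coeff r j * reduced_col lam r (I_zero lam) a" for a
    using fun_cong[OF L_mat_col[OF assms(2), of r], of a]
    by (simp add: mat_col_def cscale_def)
  show "L_mat lam r (- i) j = (if i = j then idx_sign j else 0) - (if i = I_zero lam then zero_coeff r j else 0)"
    unfolding eq using assms by (simp add: reduced_col_simps)
  show "L_mat lam r i j = skew_entry r i j - zero_coeff r j * zero_coeff r i"
    unfolding eq using assms by (simp add: reduced_col_simps skew_entry_I_zero)
qed

text \<open>
  The columns of \<open>L_mat\<close>, up to sign, are prescribed as images of the vectors spanning \<open>U_space\<close>.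
  The remaining basis vectors are fixed except the one at \<open>I_zero lam\<close>, whose image is forced
  by the requirement that \<open>e\<^sub>-\<^sub>0 - e\<^sub>+\<^sub>0\<close> is fixed.
\<close>

definition cell_matrix :: "nat list \<Rightarrow> (int \<times> int \<Rightarrow> complex) \<Rightarrow> cmat" where
  "cell_matrix lam r = (\<lambda>a b.
     if b \<in> I_set lam then unit_vec b a + (if b = I_zero lam \<and> a \<in> I_set lam then zero_coeff r a else 0)
     else idx_sign b * L_mat lam r a (- b))"

text \<open>With \<open>y j = idx_sign j * x (- j)\<close> the form is the sum of
  \<open>y i * x i\<close>. The matrix lowers \<open>y\<close> by \<open>rho\<close> at
  \<open>I_zero lam\<close> only, and adds \<open>S y\<close> and \<open>(x ?o - rho)\<close> times
  \<open>zero_coeff r\<close> to the coordinates in \<open>I_set lam\<close>. The \<open>S\<close>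
  part drops out by skewness; the other two changes contribute \<open>(x ?o - rho) * rho\<close>
  with opposite signs.\<close>

lemma cell_matrix_preserves_Q:
  assumes x: "x \<in> V_hat"
  shows "Q_tilde (mat_vec (cell_matrix lam r) x) = Q_tilde x"
proof -
  let ?o = "I_zero lam" and ?N = "cell_matrix lam r" and ?z = "zero_coeff r" and ?S = "skew_entry r"
  \<comment> \<open>The index \<open>?o\<close> is included so that \<open>F\<close> also supports
    the image, whose entry at \<open>- ?o\<close> can be nonzero even if that of \<open>x\<close> is
    0.\<close>
  define F where "F = insert ?o {j \<in> I_set lam. x (- j) \<noteq> 0}"
  have F: "finite F" "F \<subseteq> I_set lam" "?o \<in> F" and off: "\<And>j. j \<in> I_set lam - F \<Longrightarrow> x (- j) = 0"
    using finite_support_V_hat[OF x, of lam] by (auto simp: F_def)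
  define y where "y j = idx_sign j * x (- j)" for j
  define rho where "rho = (\<Sum>j\<in>F. ?z j * y j)"
  define x' where "x' = mat_vec ?N x"
  have x'_eq: "x' a = (\<Sum>b\<in>{a, ?o} \<inter> I_set lam. ?N a b * x b) + (\<Sum>j\<in>F. y j * L_mat lam r a j)" for a
  proof -
    have "x' a = (\<Sum>b\<in>({a, ?o} \<inter> I_set lam) \<union> uminus ` F. ?N a b * x b)"
      unfolding x'_def
    proof (rule mat_vec_finite_support)
      fix b assume b: "b \<notin> ({a, ?o} \<inter> I_set lam) \<union> uminus ` F"
      show "?N a b = 0 \<or> x b = 0"
      proof (cases "b \<in> I_set lam")
        case True
        then show ?thesis using b by (auto simp: cell_matrix_def unit_vec_def)
      next
        case False
        have "- b \<notin> F" using b by (metis UnI2 imageI uminus_uminus_idx)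
        then show ?thesis using False off[of "- b"] by simp
      qed
    qed (use F in simp)
    also have "\<dots> = (\<Sum>b\<in>{a, ?o} \<inter> I_set lam. ?N a b * x b) + (\<Sum>b\<in>uminus ` F. ?N a b * x b)"
      using F by (intro sum.union_disjoint) auto
    also have "(\<Sum>b\<in>uminus ` F. ?N a b * x b) = (\<Sum>j\<in>F. ?N a (- j) * x (- j))"
      by (subst sum.reindex) (auto intro: inj_onI)
    also have "\<dots> = (\<Sum>j\<in>F. y j * L_mat lam r a j)"
      using F by (intro sum.cong) (auto simp: cell_matrix_def y_def)
    finally show ?thesis .
  qed
  have x'_neg: "x' (- i) = x (- i) - (if i = ?o then rho else 0)" if i: "i \<in> I_set lam" for i
  proof -
    have "{- i, ?o} \<inter> I_set lam = {?o}"
      using i by auto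
    moreover have "?N (- i) ?o = 0"
      using i by (auto simp: cell_matrix_def unit_vec_def)
    moreover have "(\<Sum>j\<in>F. y j * L_mat lam r (- i) j)
      = (\<Sum>j\<in>F. (if j = i then x (- i) else 0) - (if i = ?o then ?z j * y j else 0))"
      using i F by (intro sum.cong) (auto simp: L_mat_entries y_def algebra_simps)
    moreover have "\<dots> = (if i \<in> F then x (- i) else 0) - (if i = ?o then rho else 0)"
      using F(1) by (simp add: sum_subtractf rho_def)
    ultimately show ?thesis
      using off[of i] i by (simp add: x'_eq)
  qed
  have x'_pos: "x' i = x i + ?z i * x ?o + (\<Sum>j\<in>F. y j * ?S i j) - ?z i * rho" if i: "i \<in> I_set lam" for i
  proof -
    have "{i, ?o} \<inter> I_set lam = {i, ?o}"
      using i by auto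
    then have "(\<Sum>b\<in>{i, ?o} \<inter> I_set lam. ?N i b * x b) = x i + ?z i * x ?o"
      using i by (cases "i = ?o") (auto simp: cell_matrix_def unit_vec_def)
    moreover have "(\<Sum>j\<in>F. y j * L_mat lam r i j) = (\<Sum>j\<in>F. y j * ?S i j - ?z i * (?z j * y j))"
      using i F by (intro sum.cong) (auto simp: L_mat_entries algebra_simps)
    ultimately show ?thesis
      by (simp add: x'_eq sum_subtractf sum_distrib_left rho_def)
  qed
  define D where "D = (\<Sum>i\<in>F. \<Sum>j\<in>F. y i * (y j * ?S i j))"
  have "D = (\<Sum>j\<in>F. \<Sum>i\<in>F. y i * (y j * ?S i j))"
    unfolding D_def by (rule sum.swap)
  also have "\<dots> = - D"
    unfolding D_def sum_negf[symmetric]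
  proof (intro sum.cong refl)
    fix i j
    show "y j * (y i * ?S j i) = - (y i * (y j * ?S i j))"
      using skew_entry_skew[of r i j] by (simp add: mult.left_commute)
  qed
  finally have "D = 0"
    by (simp add: eq_neg_iff_add_eq_0 flip: mult_2)
  then have skew: "(\<Sum>i\<in>F. y i * (\<Sum>j\<in>F. y j * ?S i j)) = 0"
    by (simp add: D_def sum_distrib_left)
  have x'_zero: "x' ?o = x ?o - rho"
    by (simp add: x'_pos skew_entry_I_zero rho_def sum_negf mult.commute)
  have "Q_tilde x' = (\<Sum>i\<in>F. idx_sign i * x' i * x' (- i))"
  proof (rule Q_tilde_I_set[of _ lam])
    show "{j \<in> I_set lam. x' (- j) \<noteq> 0} \<subseteq> F"
    proof
      fix j assume "j \<in> {j \<in> I_set lam. x' (- j) \<noteq> 0}"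
      then show "j \<in> F"
        using F(3) off[of j] x'_neg[of j] by (cases "j = ?o") auto
    qed
  qed (use F in auto)
  also have "\<dots> = (\<Sum>i\<in>F. y i * x' i - (if i = ?o then x' ?o * rho else 0))"
    using F(2) by (intro sum.cong) (auto simp: x'_neg y_def algebra_simps)
  also have "\<dots> = (\<Sum>i\<in>F. y i * x' i) - (x ?o - rho) * rho"
    using F by (simp add: sum_subtractf x'_zero)
  also have "(\<Sum>i\<in>F. y i * x' i)
    = (\<Sum>i\<in>F. y i * x i + (x ?o - rho) * (?z i * y i) + y i * (\<Sum>j\<in>F. y j * ?S i j))"
    using F(2) by (intro sum.cong) (auto simp: x'_pos algebra_simps)
  also have "\<dots> = (\<Sum>i\<in>F. y i * x i) + (x ?o - rho) * rho"
    by (simp only: sum.distrib skew rho_def[symmetric] sum_distrib_left[symmetric]) simp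
  also have "(\<Sum>i\<in>F. y i * x i) = Q_tilde x"
  proof -
    have "{j \<in> I_set lam. x (- j) \<noteq> 0} \<subseteq> F"
      by (auto simp: F_def)
    then show ?thesis
      using Q_tilde_I_set[OF F(1) _ F(2)] by (simp add: y_def mult.commute mult.left_commute)
  qed
  finally show ?thesis
    unfolding x'_def by simp
qed

text \<open>The columns at the two zeros differ from their unit vectors by the same vector
  \<open>R\<close>, which cancels in the difference whichever zero lies in
  \<open>I_set lam\<close>.\<close>

lemma cell_matrix_fixes: "mat_vec (cell_matrix lam r) (unit_vec (Neg 0) - unit_vec (Pos 0)) = unit_vec (Neg 0) - unit_vec (Pos 0)"
proof -
  let ?o = "I_zero lam" and ?N = "cell_matrix lam r"
  define R :: cvec where "R = (\<lambda>a. if a \<in> I_set lam then zero_coeff r a else 0)"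
  have o: "mat_col ?N ?o = unit_vec ?o + R"
    by (auto simp: fun_eq_iff mat_col_def cell_matrix_def R_def)
  have o': "mat_col ?N (- ?o) = unit_vec (- ?o) + R"
  proof
    fix a
    show "mat_col ?N (- ?o) a = (unit_vec (- ?o) + R) a"
    proof (cases "a \<in> I_set lam")
      case True
      then show ?thesis
        by (auto simp: mat_col_def cell_matrix_def R_def L_mat_entries skew_entry_I_zero unit_vec_def)
    next
      case False
      then obtain i where "i \<in> I_set lam" "a = - i"
        by (metis uminus_in_I_set uminus_uminus_idx)
      then show ?thesis
        by (auto simp: mat_col_def cell_matrix_def R_def L_mat_entries unit_vec_def)
    qed
  qed
  have diff: "unit_vec (Neg 0) - unit_vec (Pos 0) = unit_vec (Neg 0) + cscale (- 1) (unit_vec (Pos 0))"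
    by (simp add: fun_eq_iff cscale_def)
  have "mat_vec ?N (unit_vec (Neg 0) - unit_vec (Pos 0)) = mat_col ?N (Neg 0) + cscale (- 1) (mat_col ?N (Pos 0))"
  proof -
    have "finite {b. unit_vec (Neg 0) b \<noteq> 0}" "finite {b. cscale (- 1) (unit_vec (Pos 0)) b \<noteq> 0}"
      by (simp_all add: unit_vec_def cscale_def)
    then show ?thesis
      unfolding diff by (simp only: mat_vec_add mat_vec_cscale mat_vec_unit_vec)
  qed
  also have "\<dots> = unit_vec (Neg 0) - unit_vec (Pos 0)"
    using o o' by (auto simp: I_zero_def fun_eq_iff cscale_def split: if_splits)
  finally show ?thesis .
qed

lemma cell_matrix_in_N_minus: "cell_matrix lam r \<in> N_minus"
proof -
  let ?N = "cell_matrix lam r"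
  have low: "?N a b = (if a = b then 1 else 0)" if "a \<le> b" for a b
  proof (cases "b \<in> I_set lam")
    case True
    then show ?thesis
      using that by (cases a; cases b) (auto simp: cell_matrix_def unit_vec_def zero_coeff_def I_zero_def split: if_splits)
  next
    case False
    define j where "j = - b"
    have j: "j \<in> I_set lam" "b = - j"
      using False by (simp_all add: j_def)
    show ?thesis
    proof (cases "a \<in> I_set lam")
      case True
      \<comment> \<open>This excludes both nonzero cases of \<open>skew_entry\<close> and also a
        positive pair in the quadratic term.\<close>
      have "ival a \<le> - ival j"
        using that j by (cases a; cases j) auto
      moreover have "a \<noteq> b"
        using True False by blast
      ultimately show ?thesis
        using True False j by (auto simp: cell_matrix_def L_mat_entries skew_entry_def zero_coeff_def)
    next
      case nI: False
      define i where "i = - a"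
      have i: "i \<in> I_set lam" "a = - i"
        using nI by (simp_all add: i_def)
      have "j \<le> i"
        using that i j by (simp add: idx_uminus_le_iff)
      \<comment> \<open>The extra entry in a zero row occurs only for positive \<open>j\<close>,
        hence in a column \<open>- j\<close> strictly to the left of both zeros.\<close>
      then have "zero_coeff r j = 0" if "i = I_zero lam"
        using that by (cases j; cases i) (auto simp: zero_coeff_def I_zero_def split: if_splits)
      then show ?thesis
        using i j by (auto simp: cell_matrix_def L_mat_entries)
    qed
  qed
  show ?thesis
    unfolding N_minus_def using low cell_matrix_preserves_Q cell_matrix_fixes by auto
qed

lemma column_span_in_schubert_cell: "column_span lam r \<in> schubert_cell lam"
proof -
  let ?N = "cell_matrix lam r"
  have "mat_vec ?N ` U_space lam = cvec.span ((\<lambda>j. mat_col ?N (- j)) ` I_set lam)"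
    unfolding U_space_eq mat_vec_span_unit_vec by (simp only: image_image)
  also have "\<dots> = cvec.span ((\<lambda>j. cscale (idx_sign j) (mat_col (L_mat lam r) j)) ` I_set lam)"
    by (intro arg_cong[of _ _ cvec.span] image_cong) (auto simp: fun_eq_iff mat_col_def cell_matrix_def cscale_def)
  also have "\<dots> = cvec.span (mat_col (L_mat lam r) ` I_set lam)"
    by (rule span_image_cscale) simp
  also have "\<dots> = column_span lam r"
    unfolding column_span_def by (rule arg_cong[of _ _ cvec.span]) blast
  finally show ?thesis
    using cell_matrix_in_N_minus unfolding schubert_cell_def by blast
qed

theorem theorem1p2:
  fixes lam :: "nat list"
  assumes "strict_partition lam"
  shows "bij_betw (column_span lam) (r_families lam) (schubert_cell lam)"
  using column_span_inj schubert_cell_subset column_span_in_schubert_cell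
  unfolding bij_betw_def by blast

end
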